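(* Let $K$ be a field of characteristic zero and let $\mathfrak{g}$ be a finite-dimensional nilpotent Lie algebra over $K$ which is a stem Lie algebra, i.e. $Z(\mathfrak{g})\subseteq[\mathfrak{g},\mathfrak{g}]$. Then every CPA-structure on $\mathfrak{g}$ is complete.
   Context: A commutative post-Lie algebra structure, or CPA-structure, on a Lie algebra $\mathfrak{g}$ over $K$ is a $K$-bilinear product $x\cdot y$ on the vector space $\mathfrak{g}$ such that for all $x,y,z\in\mathfrak{g}$: (1) $x\cdot y=y\cdot x$; (2) $[x,y]\cdot z=x\cdot(y\cdot z)-y\cdot(x\cdot z)$; (3) $x\cdot[y,z]=[x\cdot y,z]+[y,x\cdot z]$. Write $L(x)(y)=x\cdot y$ and $R(x)(y)=y\cdot x$ for the left and right multiplication operators. A CPA-structure is called complete if all left multiplication operators $L(x)$, $x\in\mathfrak{g}$ (and hence all right multiplication operators $R(x)$) are nilpotent linear maps. $Z(\mathfrak{g})$ denotes the center of $\mathfrak{g}$. *)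

theory Defs
  imports Complex_Main
begin

definition bilinear_map ::
  "('k::field \<Rightarrow> 'g::ab_group_add \<Rightarrow> 'g) \<Rightarrow> ('g \<Rightarrow> 'g \<Rightarrow> 'g) \<Rightarrow> bool"
where
  "bilinear_map scale b \<longleftrightarrow>
     (\<forall>x. Vector_Spaces.linear scale scale (\<lambda>y. b x y)) \<and>
     (\<forall>y. Vector_Spaces.linear scale scale (\<lambda>x. b x y))"

locale lie_algebra = vector_space scale
  for scale :: "'k::field \<Rightarrow> 'g::ab_group_add \<Rightarrow> 'g" +
  fixes bracket :: "'g \<Rightarrow> 'g \<Rightarrow> 'g"
  assumes bracket_bilinear: "bilinear_map scale bracket"
    and bracket_alternating: "bracket x x = 0"
    and jacobi:
      "bracket x (bracket y z) + bracket y (bracket z x) + bracket z (bracket x y) = 0"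
begin

definition finite_dimensional :: bool where
  "finite_dimensional \<longleftrightarrow> (\<exists>B. finite B \<and> span B = UNIV)"

definition commutator_space :: "'g set \<Rightarrow> 'g set \<Rightarrow> 'g set" where
  "commutator_space S T = span {bracket x y | x y. x \<in> S \<and> y \<in> T}"

definition center :: "'g set" where
  "center = {z. \<forall>x. bracket z x = 0}"

primrec lower_central_series :: "nat \<Rightarrow> 'g set" where
  "lower_central_series 0 = UNIV"
| "lower_central_series (Suc n) = commutator_space UNIV (lower_central_series n)"

definition nilpotent :: bool where
  "nilpotent \<longleftrightarrow> (\<exists>n. lower_central_series n = {0})"

definition stem :: bool where
  "stem \<longleftrightarrow> center \<subseteq> commutator_space UNIV UNIV"

definition cpa_structure :: "('g \<Rightarrow> 'g \<Rightarrow> 'g) \<Rightarrow> bool" where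
  "cpa_structure p \<longleftrightarrow>
     bilinear_map scale p \<and>
     (\<forall>x y. p x y = p y x) \<and>
     (\<forall>x y z. p (bracket x y) z = p x (p y z) - p y (p x z)) \<and>
     (\<forall>x y z. p x (bracket y z) = bracket (p x y) z + bracket y (p x z))"

end

definition nilpotent_map :: "('g::zero \<Rightarrow> 'g) \<Rightarrow> bool" where
  "nilpotent_map f \<longleftrightarrow> (\<exists>n. \<forall>v. (f ^^ n) v = 0)"

text \<open>The partial application \<open>p x\<close> is the left multiplication operator \<open>L(x)\<close>; for
  a commutative product it coincides with \<open>R(x)\<close>.\<close>

definition complete_product :: "('g::zero \<Rightarrow> 'g \<Rightarrow> 'g) \<Rightarrow> bool" where
  "complete_product p \<longleftrightarrow> (\<forall>x. nilpotent_map (p x))"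

end

theory Submission
  imports Defs
begin

text \<open>
  Write \<open>F\<^sub>n\<close> for the lower central series, so \<open>F\<^sub>1 = [\<gg>,\<gg>]\<close>. The axioms give
  \<open>L(x\<cdot>z) = L(x)L(z) - L(z) ad(x)\<close>; hence \<open>L\<close> is multiplicative modulo operators that
  raise the filtration \<open>F\<close>, the quotient \<open>\<gg>/F\<^sub>1\<close> is commutative and associative, and
  \<open>F\<^sub>1\<cdot>F\<^sub>n \<subseteq> F\<^sub>n\<^sub>+\<^sub>1\<close>. If \<open>L(x)\<close> is not nilpotent, then \<open>x\<close> is not nilpotent in \<open>\<gg>/F\<^sub>1\<close>, so
  \<open>\<gg>/F\<^sub>1\<close> contains a nonzero idempotent, which lifts along the filtration to some
  \<open>y \<notin> F\<^sub>1\<close> with \<open>y\<cdot>y = y\<close>. For such \<open>y\<close> the axioms force \<open>ad(y) = 0\<close>, so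
  \<open>y \<in> Z(\<gg>) \<subseteq> F\<^sub>1\<close>, a contradiction.
\<close>

text \<open>The ranges decrease, so one of least dimension equals all later ones.\<close>

lemma (in finite_dimensional_vector_space) range_funpow_stabilizes:
  assumes "Vector_Spaces.linear scale scale f"
  obtains k where "\<And>j. range (f ^^ k) = range (f ^^ (k + j))"
proof -
  interpret f: Vector_Spaces.linear scale scale f
    by (rule assms)
  have sub: "subspace (range (f ^^ n))" for n
  proof (induction n)
    case (Suc n)
    have "range (f ^^ Suc n) = f ` range (f ^^ n)"
      by auto
    then show ?case
      using f.subspace_image[OF Suc] by simp
  qed simp
  obtain k where k: "\<And>n. dim (range (f ^^ k)) \<le> dim (range (f ^^ n))"
    using ex_has_least_nat[where P = "\<lambda>_. True" and m = "\<lambda>n. dim (range (f ^^ n))"] by auto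
  have "range (f ^^ k) = range (f ^^ (k + j))" for j
  proof -
    have "range (f ^^ (k + j)) \<subseteq> range (f ^^ k)"
      by (auto simp: funpow_add)
    from subspace_dim_equal[OF sub sub this k] show ?thesis
      by simp
  qed
  then show thesis
    by (rule that)
qed

section \<open>The lower central series\<close>

context lie_algebra
begin

lemma bracket_in_lower_central_series:
  "w \<in> lower_central_series n \<Longrightarrow> bracket x w \<in> lower_central_series (Suc n)"
  by (auto simp: commutator_space_def intro: span_base)

lemma subspace_lower_central_series: "subspace (lower_central_series n)"
  by (cases n) (simp_all add: commutator_space_def)

lemma lower_central_series_Suc_subset: "lower_central_series (Suc n) \<subseteq> lower_central_series n"
proof (induction n)
  case (Suc n)
  then show ?case
    unfolding lower_central_series.simps(2)[of "Suc n"] lower_central_series.simps(2)[of n]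
      commutator_space_def
    by (intro span_mono) (use Suc in \<open>auto simp: commutator_space_def\<close>)
qed simp

lemma lower_central_series_antimono:
  "m \<le> n \<Longrightarrow> lower_central_series n \<subseteq> lower_central_series m"
  by (rule lift_Suc_antimono_le[where f = lower_central_series, OF lower_central_series_Suc_subset])

lemmas lcs_add = subspace_add[OF subspace_lower_central_series]
  and lcs_diff = subspace_diff[OF subspace_lower_central_series]

lemma stem_iff: "stem \<longleftrightarrow> center \<subseteq> lower_central_series 1"
  by (simp add: stem_def)

end

section \<open>The product and the filtration\<close>

locale cpa_algebra = lie_algebra scale bracket
  for scale :: "'k::field \<Rightarrow> 'g::ab_group_add \<Rightarrow> 'g" and bracket +
  fixes p :: "'g \<Rightarrow> 'g \<Rightarrow> 'g"
  assumes cpa: "cpa_structure p"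
begin

abbreviation F where "F \<equiv> lower_central_series"

lemma p_linear: "Vector_Spaces.linear scale scale (p x)"
  using cpa by (simp add: cpa_structure_def bilinear_map_def)

lemma p_commute: "p x y = p y x"
  using cpa by (simp add: cpa_structure_def)

lemma p_bracket_left: "p (bracket x y) z = p x (p y z) - p y (p x z)"
  using cpa unfolding cpa_structure_def by blast

lemma p_bracket_right: "p x (bracket y z) = bracket (p x y) z + bracket y (p x z)"
  using cpa unfolding cpa_structure_def by blast

lemma p_add_right: "p x (y + z) = p x y + p x z"
  and p_diff_right: "p x (y - z) = p x y - p x z"
proof -
  interpret Vector_Spaces.linear scale scale "p x"
    by (rule p_linear)
  show "p x (y + z) = p x y + p x z" "p x (y - z) = p x y - p x z"
    by (simp_all add: add diff)
qed

lemma p_add_left: "p (x + y) z = p x z + p y z"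
  by (simp add: p_commute[of _ z] p_add_right)

lemma p_p_left: "p (p x z) w = p x (p z w) - p z (bracket x w)"
  using p_bracket_left[of x w z] by (simp add: p_commute algebra_simps)

text \<open>Each \<open>p x\<close> is a derivation of the bracket.\<close>

lemma p_in_F: "w \<in> F n \<Longrightarrow> p x w \<in> F n"
proof (induction n arbitrary: w)
  case (Suc n)
  have "p x w \<in> F (Suc n)" if "w \<in> span {bracket a b |a b. a \<in> UNIV \<and> b \<in> F n}" for w
    using that
  proof (induction rule: span_induct)
    case base
    interpret Vector_Spaces.linear scale scale "p x"
      by (rule p_linear)
    show ?case
      using subspace_vimage[OF subspace_lower_central_series[of "Suc n"]] by (simp add: vimage_def)
  next
    case (step w)
    then show ?case
      by (auto simp: p_bracket_right simp del: lower_central_series.simps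
          intro!: lcs_add bracket_in_lower_central_series Suc.IH)
  qed
  then show ?case
    using Suc.prems by (simp add: commutator_space_def)
qed simp

text \<open>For \<open>c = bracket a b\<close>, L(c) is the commutator of L(a) and L(b). Rewriting
  both products by \<open>p_p_left\<close> cancels L(ab) against L(ba) and leaves L(b)ad(a) -
  L(a)ad(b).\<close>

lemma p_F1_raises:
  assumes "c \<in> F 1" "w \<in> F n"
  shows "p c w \<in> F (Suc n)"
proof -
  have "c \<in> span {bracket a b |a b. a \<in> UNIV \<and> b \<in> UNIV}"
    using assms(1) by (simp add: commutator_space_def)
  then have "p w c \<in> F (Suc n)"
  proof (induction rule: span_induct)
    case base
    interpret Vector_Spaces.linear scale scale "p w"
      by (rule p_linear)
    show ?case
      using subspace_vimage[OF subspace_lower_central_series[of "Suc n"]] by (simp add: vimage_def)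
  next
    case (step c)
    then obtain a b where c: "c = bracket a b"
      by blast
    have "p x (p y w) = p (p x y) w + p y (bracket x w)" for x y
      by (simp add: p_p_left)
    from this[of a b] this[of b a] have "p c w = p b (bracket a w) - p a (bracket b w)"
      by (simp add: c p_bracket_left p_commute[of b a])
    also have "\<dots> \<in> F (Suc n)"
      using assms(2) by (intro lcs_diff p_in_F bracket_in_lower_central_series)
    finally show ?case
      by (simp add: p_commute)
  qed
  then show ?thesis
    by (simp add: p_commute)
qed

text \<open>Here \<open>(p x ^^ k) x\<close> is the power of \<open>x\<close> with k+1 factors,
  hence \<open>Suc k\<close> on the left. Absorbing one more factor costs one bracket term.\<close>

lemma funpow_p_cong:
  assumes "w \<in> F n"
  shows "(p x ^^ Suc k) w - p ((p x ^^ k) x) w \<in> F (Suc n)"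
proof (induction k)
  case 0
  show ?case
    using subspace_0[OF subspace_lower_central_series[of "Suc n"]] by simp
next
  case (Suc k)
  let ?u = "(p x ^^ k) x"
  have "(p x ^^ Suc (Suc k)) w - p ((p x ^^ Suc k) x) w
      = p x ((p x ^^ Suc k) w - p ?u w) + p ?u (bracket x w)"
    by (simp add: p_p_left p_diff_right)
  also have "\<dots> \<in> F (Suc n)"
    using assms Suc by (intro lcs_add p_in_F bracket_in_lower_central_series)
  finally show ?case .
qed

lemma nilpotent_map_if_power_in_F1:
  assumes "nilpotent" "(p x ^^ k) x \<in> F 1"
  shows "nilpotent_map (p x)"
proof -
  have raise: "(p x ^^ Suc k) w \<in> F (Suc n)" if "w \<in> F n" for w n
    using lcs_add[OF funpow_p_cong[OF that, of k x] p_F1_raises[OF assms(2) that]] by simp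
  have "((p x ^^ Suc k) ^^ n) v \<in> F n" for n v
  proof (induction n)
    case (Suc n)
    then show ?case
      using raise[OF Suc] by (simp del: lower_central_series.simps)
  qed simp
  then have pow: "(p x ^^ (Suc k * n)) v \<in> F n" for n v
    by (simp only: funpow_mult mult.commute)
  obtain n where "F n = {0}"
    using assms(1) by (auto simp: nilpotent_def)
  then show ?thesis
    using pow[of n] unfolding nilpotent_map_def by blast
qed

section \<open>Idempotents and their lifting\<close>

text \<open>The power \<open>w\<close> of \<open>x\<close> below is von Neumann regular modulo \<open>F 1\<close>, that is
  \<open>w \<equiv> w\<cdot>(w\<cdot>u)\<close>, so \<open>w\<cdot>u\<close> is idempotent modulo \<open>F 1\<close>.\<close>

lemma idempotent_mod_F1:
  assumes "finite_dimensional" "\<And>k. (p x ^^ k) x \<notin> F 1"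
  obtains e where "p e e - e \<in> F 1" "e \<notin> F 1"
proof -
  obtain S where S: "finite S" "span S = UNIV"
    using assms(1) by (auto simp: finite_dimensional_def)
  obtain B where B: "B \<subseteq> S" "independent B" "span B = UNIV"
    using maximal_independent_subset[of S] S(2) span_span span_mono
    by (metis span_eq top.extremum_uniqueI subset_UNIV)
  interpret finite_dimensional_vector_space scale B
    using B S(1) by unfold_locales (auto intro: finite_subset)
  obtain k where k: "\<And>j. range (p x ^^ k) = range (p x ^^ (k + j))"
    using range_funpow_stabilizes[OF p_linear] by blast
  define w where "w = (p x ^^ k) x"
  \<comment> \<open>The exponent 2k+2 splits into two copies of L(x)^(k+1), each congruent to
    L(w).\<close>
  have "w \<in> range (p x ^^ (k + Suc (Suc k)))"
    unfolding w_def using k by blast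
  then obtain u where u: "w = (p x ^^ (Suc k + Suc k)) u"
    by auto
  have cong: "(p x ^^ Suc k) v - p w v \<in> F 1" for v
    using funpow_p_cong[of v 0 k x] by (simp add: w_def)
  define e where "e = p w u"
  have we: "w - p w e \<in> F 1"
  proof -
    have "w - p w e = ((p x ^^ Suc k) ((p x ^^ Suc k) u) - p w ((p x ^^ Suc k) u))
        + p w ((p x ^^ Suc k) u - p w u)"
      unfolding e_def p_diff_right by (subst u) (simp only: funpow_add o_apply, simp)
    also have "\<dots> \<in> F 1"
      by (intro lcs_add p_in_F cong)
    finally show ?thesis .
  qed
  \<comment> \<open>As \<open>e = p u w\<close>, it suffices to reorder (wu)e into u(we), at the
    cost of brackets.\<close>
  have "p e e - e = p (bracket w u) e - p u (bracket w e) - p u (w - p w e)"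
    using p_p_left[of w u e] p_bracket_left[of w u e]
    by (simp add: e_def p_diff_right p_commute[of u w])
  also have "\<dots> \<in> F 1"
  proof (intro lcs_diff)
    have br: "bracket a b \<in> F 1" for a b
      using bracket_in_lower_central_series[of b 0 a] by simp
    show "p (bracket w u) e \<in> F 1"
      using p_in_F[OF br] by (metis p_commute)
    show "p u (bracket w e) \<in> F 1"
      by (rule p_in_F[OF br])
    show "p u (w - p w e) \<in> F 1"
      by (rule p_in_F[OF we])
  qed
  finally have "p e e - e \<in> F 1" .
  moreover have "e \<notin> F 1"
  proof
    assume "e \<in> F 1"
    then have "w \<in> F 1"
      using lcs_add[OF we p_in_F[of e 1 w]] by simp
    then show False
      using assms(2) by (simp add: w_def)
  qed
  ultimately show thesis
    by (rule that)
qed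

text \<open>The correction \<open>s\<close> solves \<open>(2L(y) - 1)s \<equiv> -r\<close>, because \<open>2L(y) - 1\<close> is an involution
  modulo operators raising the filtration.\<close>

lemma lift_idempotent_step:
  assumes "p y y - y \<in> F (Suc n)"
  obtains z where "p z z - z \<in> F (Suc (Suc n))" "z - y \<in> F (Suc n)"
proof -
  define r where "r = p y y - y"
  define s where "s = r - p y r - p y r"
  have r: "r \<in> F (Suc n)"
    using assms by (simp only: r_def)
  have s: "s \<in> F (Suc n)"
    unfolding s_def by (intro lcs_diff p_in_F r)
  have F1: "F (Suc n) \<subseteq> F 1"
    by (rule lower_central_series_antimono) simp
  define q where "q = p r r + p y (bracket y r)"
  have q: "q \<in> F (Suc (Suc n))"
    unfolding q_def using F1 r
    by (intro lcs_add p_F1_raises p_in_F bracket_in_lower_central_series) auto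
  have yy: "p y y = y + r"
    by (simp add: r_def)
  \<comment> \<open>On \<open>r\<close>, the operator \<open>p y\<close> is idempotent up to the
    error \<open>q\<close>.\<close>
  have yyr: "p y (p y r) = p y r + q"
    using p_p_left[of y y r] by (simp add: yy p_add_left q_def algebra_simps)
  have "p (y + s) (y + s) - (y + s) = r + (p y s + p y s - s) + p s s"
    by (simp add: p_add_left p_add_right p_commute[of s y] yy)
  also have "p y s + p y s - s = - r - (q + q + q + q)"
    by (simp add: s_def p_diff_right yyr)
  also have "r + (- r - (q + q + q + q)) + p s s = p s s - (q + q + q + q)"
    by simp
  also have "\<dots> \<in> F (Suc (Suc n))"
    using F1 s by (intro lcs_diff lcs_add q p_F1_raises) auto
  finally show thesis
    using s by (intro that[of "y + s"]) (simp_all only: add_diff_cancel_left')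
qed

text \<open>All corrections lie in \<open>F 1\<close>, so the class of \<open>e\<close> is
  kept.\<close>

lemma lift_idempotent:
  assumes "p e e - e \<in> F 1"
  shows "\<exists>y. p y y - y \<in> F (Suc n) \<and> y - e \<in> F 1"
proof (induction n)
  case 0
  show ?case
    using assms subspace_0[OF subspace_lower_central_series[of 1]] by (intro exI[of _ e]) simp
next
  case (Suc n)
  then obtain y where y: "p y y - y \<in> F (Suc n)" "y - e \<in> F 1"
    by blast
  obtain z where z: "p z z - z \<in> F (Suc (Suc n))" "z - y \<in> F (Suc n)"
    using lift_idempotent_step[OF y(1)] .
  have "z - y \<in> F 1"
    using z(2) lower_central_series_antimono[of 1 "Suc n"] by auto
  from lcs_add[OF this y(2)] show ?case
    using z(1) by auto
qed

text \<open>With \<open>T = L(y)\<close> and \<open>A = ad(y)\<close>, the axioms at the idempotent \<open>y\<close> read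
  \<open>T = T\<^sup>2 - TA\<close> and \<open>TA = A + AT\<close>. The first makes \<open>TA\<close> commute with \<open>T\<close>, so the second gives
  \<open>TA = 0\<close>; then \<open>T\<^sup>2 = T\<close> and \<open>A = -AT\<close>, hence \<open>2A = 0\<close>.\<close>

lemma idempotent_central:
  assumes "p y y = y" "(2::'k) \<noteq> 0"
  shows "y \<in> center"
proof -
  have i: "p y (bracket y w) = p y (p y w) - p y w" for w
    using p_p_left[of y y w] by (simp add: assms(1) algebra_simps)
  have ii: "p y (bracket y w) = bracket y w + bracket y (p y w)" for w
    by (simp add: p_bracket_right assms(1))
  have TA: "p y (bracket y w) = 0" for w
  proof -
    have "p y (p y (bracket y w)) = p y (bracket y w) + p y (bracket y (p y w))"
      using ii[of w] by (simp add: p_add_right)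
    moreover have "p y (p y (bracket y w)) = p y (bracket y (p y w))"
      by (simp add: i p_diff_right)
    ultimately show ?thesis
      by simp
  qed
  have T: "p y (p y w) = p y w" for w
    using i[of w] TA[of w] by simp
  have "bracket y w = 0" for w
  proof -
    have A: "bracket y v + bracket y (p y v) = 0" for v
      using ii[of v] TA[of v] by simp
    have "scale 2 (bracket y (p y w)) = bracket y (p y w) + bracket y (p y w)"
      using scale_left_distrib[of 1 1 "bracket y (p y w)"] by simp
    also have "\<dots> = 0"
      using A[of "p y w"] by (simp add: T)
    finally have "bracket y (p y w) = 0"
      using assms(2) by simp
    then show ?thesis
      using A[of w] by simp
  qed
  then show ?thesis
    by (simp add: center_def)
qed

lemma complete:
  assumes "finite_dimensional" "nilpotent" "stem" "(2::'k) \<noteq> 0"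
  shows "complete_product p"
  unfolding complete_product_def
proof (intro allI, rule ccontr)
  fix x
  assume "\<not> nilpotent_map (p x)"
  then have "(p x ^^ k) x \<notin> F 1" for k
    using nilpotent_map_if_power_in_F1[OF assms(2)] by blast
  then obtain e where e: "p e e - e \<in> F 1" "e \<notin> F 1"
    using idempotent_mod_F1[OF assms(1)] by blast
  obtain n where n: "F n = {0}"
    using assms(2) by (auto simp: nilpotent_def)
  obtain y where y: "p y y - y \<in> F (Suc n)" "y - e \<in> F 1"
    using lift_idempotent[OF e(1)] by blast
  have "p y y = y"
    using y(1) lower_central_series_Suc_subset[of n] n by auto
  from idempotent_central[OF this assms(4)] have "y \<in> F 1"
    using assms(3) by (auto simp only: stem_iff)
  from lcs_diff[OF this y(2)] have "e \<in> F 1"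
    by simp
  with e(2) show False ..
qed

end

theorem theorem3p6:
  fixes scale :: "'k::field_char_0 \<Rightarrow> 'g::ab_group_add \<Rightarrow> 'g"
    and bracket :: "'g \<Rightarrow> 'g \<Rightarrow> 'g"
    and p :: "'g \<Rightarrow> 'g \<Rightarrow> 'g"
  assumes "lie_algebra scale bracket"
    and "lie_algebra.finite_dimensional scale"
    and "lie_algebra.nilpotent scale bracket"
    and "lie_algebra.stem scale bracket"
    and "lie_algebra.cpa_structure scale bracket p"
  shows "complete_product p"
proof -
  interpret cpa_algebra scale bracket p
    using assms(1,5) by (simp add: cpa_algebra_def cpa_algebra_axioms_def)
  show ?thesis
    using complete assms(2-4) by simp
qed

end
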